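(* For every $n\ge2$, every $S=(s_1,\ldots,s_n)\in\mathcal{G}_n$ and every $k\in\mathbb{Z}$, $k\in K_S$ if and only if $2s_n-k\in K_S$. Hence $K_S$, $C_S$, and $H_S$ are symmetric about $s_n$ (that is, each is invariant under $k\mapsto 2s_n-k$).
   Context: For a finite integer sequence $S=(s_1,\ldots,s_n)$, its difference triangle is defined by $s_a^0:=s_a$ and $s_a^b:=|s_{a+1}^{b-1}-s_a^{b-1}|$ for $b\ge 1$, $1\le a\le n-b$ (superscripts are row indices, not powers). $S$ is Gilbreath if $s_1^b=1$ for every $1\le b\le n-1$. For $n\ge 2$, $\mathcal{G}_n$ is the set of strictly increasing Gilbreath integer sequences $(s_1,\ldots,s_n)$ of length $n$ with $(s_1,s_2)=(2,3)$. The valid-extension set of $S$ is $K_S:=\{k\in\mathbb{Z}:(s_1,\ldots,s_n,k)\text{ is Gilbreath}\}$. The right anti-diagonal of $S$ is $(e_1,\ldots,e_{n-1})$ with $e_i:=s_{n-i}^i$, and $A(S):=\sum_{i=1}^{n-1}e_i$. The candidate set is $C_S:=\{k\in\mathbb{Z}:|k-s_n|\le A(S)+1,\ k\equiv s_n\pmod 2\}$, and the hole set is $H_S:=C_S\setminus K_S$. *)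

theory Defs
  imports "HOL-Number_Theory.Cong"
begin

(* difference_triangle S b a is s_a^b, with the position a counted from 1. The value is
   meaningful only for 1 <= a <= length S - b; no definition below uses it elsewhere. *)
fun difference_triangle :: "int list \<Rightarrow> nat \<Rightarrow> nat \<Rightarrow> int" where
  "difference_triangle S 0 a = S ! (a - 1)"
| "difference_triangle S (Suc b) a =
     \<bar>difference_triangle S b (a + 1) - difference_triangle S b a\<bar>"

definition gilbreath :: "int list \<Rightarrow> bool" where
  "gilbreath S \<longleftrightarrow> (\<forall>b. 1 \<le> b \<and> b \<le> length S - 1 \<longrightarrow> difference_triangle S b 1 = 1)"

(* take 2 S = [2, 3] also forces length S >= 2, so the set is empty for n < 2. *)
definition gilbreath_sequences :: "nat \<Rightarrow> int list set" where
  "gilbreath_sequences n =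
     {S. length S = n \<and> sorted_wrt (<) S \<and> gilbreath S \<and> take 2 S = [2, 3]}"

definition valid_extensions :: "int list \<Rightarrow> int set" where
  "valid_extensions S = {k. gilbreath (S @ [k])}"

(* The entry e_i of the right anti-diagonal, for 1 <= i <= length S - 1. *)
definition right_antidiagonal :: "int list \<Rightarrow> nat \<Rightarrow> int" where
  "right_antidiagonal S i = difference_triangle S i (length S - i)"

definition antidiagonal_sum :: "int list \<Rightarrow> int" where
  "antidiagonal_sum S = (\<Sum>i = 1..length S - 1. right_antidiagonal S i)"

definition candidate_set :: "int list \<Rightarrow> int set" where
  "candidate_set S = {k. \<bar>k - last S\<bar> \<le> antidiagonal_sum S + 1 \<and> [k = last S] (mod 2)}"

definition hole_set :: "int list \<Rightarrow> int set" where
  "hole_set S = candidate_set S - valid_extensions S"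

end

theory Submission
  imports Defs
begin

text \<open>The reflection only negates the last step \<open>k - last S\<close>. Row 1 sees its
  absolute value, and \<open>gilbreath\<close> ignores row 0
  (\<open>difference_triangle_reflect_last\<close>); candidates depend only on its size and parity;
  holes are a set difference.\<close>

text \<open>
  The last element of an extended sequence enters row 1 of the triangle only through its
  distance to the element before it, and all later rows are computed from row 1.
\<close>

lemma difference_triangle_reflect_last:
  assumes "1 \<le> b" "1 \<le> a" "a + b \<le> length S + 1"
  shows "difference_triangle (S @ [2 * last S - k]) b a = difference_triangle (S @ [k]) b a"
  using assms
proof (induction b arbitrary: a rule: dec_induct)
  case base
  then show ?case
    \<comment> \<open>Only the entry at \<open>a = length S\<close> involves
      \<open>k\<close>.\<close>
    by (cases "a = length S") (auto simp: nth_append last_conv_nth)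
next
  case (step b)
  then show ?case by simp
qed

lemma gilbreath_reflect_last:
  "gilbreath (S @ [2 * last S - k]) \<longleftrightarrow> gilbreath (S @ [k])"
  unfolding gilbreath_def by (simp add: difference_triangle_reflect_last)

lemma candidate_set_reflect: "2 * last S - k \<in> candidate_set S \<longleftrightarrow> k \<in> candidate_set S"
proof -
  have "[2 * last S - k = last S] (mod 2) \<longleftrightarrow> [k = last S] (mod 2)"
    by (auto simp: cong_iff_dvd_diff)
  moreover have "\<bar>2 * last S - k - last S\<bar> = \<bar>k - last S\<bar>"
    by simp
  ultimately show ?thesis
    by (simp add: candidate_set_def)
qed

text \<open>Reflection is an involution, so invariance of membership upgrades to equality of sets:
  \<open>c - k\<close> is the preimage of \<open>k\<close>.\<close>

lemma image_reflect_eq: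
  fixes c :: "'a::ab_group_add"
  assumes "\<And>k. c - k \<in> A \<longleftrightarrow> k \<in> A"
  shows "(\<lambda>k. c - k) ` A = A"
proof -
  have "k \<in> (\<lambda>k. c - k) ` A" if "k \<in> A" for k
    using assms that by (intro image_eqI[of _ _ "c - k"]) auto
  with assms show ?thesis by auto
qed

theorem theorem16:
  fixes n :: nat and S :: "int list"
  assumes "n \<ge> 2" and "S \<in> gilbreath_sequences n"
  shows "(\<forall>k::int. k \<in> valid_extensions S \<longleftrightarrow> 2 * last S - k \<in> valid_extensions S)
    \<and> (\<lambda>k. 2 * last S - k) ` valid_extensions S = valid_extensions S
    \<and> (\<lambda>k. 2 * last S - k) ` candidate_set S = candidate_set S
    \<and> (\<lambda>k. 2 * last S - k) ` hole_set S = hole_set S"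
proof -
  have "2 * last S - k \<in> valid_extensions S \<longleftrightarrow> k \<in> valid_extensions S" for k
    by (simp add: valid_extensions_def gilbreath_reflect_last)
  then show ?thesis
    by (simp add: image_reflect_eq hole_set_def candidate_set_reflect)
qed

end
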